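(* For all integers $k\ge2$ and all $m,n\in\{1,2,3\}$, $$\left[\mathcal{H}_{\mathbf{g}^*_n,2k},\sqrt2\,\mathbf{G}^{0,m}\right]=\mathcal{H}_{[\mathbf{g}^*_n,\mathbf{g}^*_m],2k},\qquad \left[\mathcal{H}_{\mathbf{g}^*_n,2k},\sqrt2\,\mathbf{G}^{1,m}\right]=\mathcal{H}_{[\mathbf{g}^*_n,\mathbf{g}^*_m],2k+1},$$ $$\left[\mathcal{H}_{\mathbf{g}^*_n,2k+1},\sqrt2\,\mathbf{G}^{0,m}\right]=\mathcal{H}_{[\mathbf{g}^*_n,\mathbf{g}^*_m],2k+1},\qquad \left[\mathcal{H}_{\mathbf{g}^*_n,2k+1},\sqrt2\,\mathbf{G}^{1,m}\right]=\mathcal{H}_{[\mathbf{g}^*_n,\mathbf{g}^*_m],2k+2}.$$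
   Context: Elements of $\prod_{i=0}^\infty\mathbb{R}^3$ are written $\mathfrak{m}=(\mathbf{m}_0,\mathbf{m}_1,\mathbf{m}_2,\dots)$ with $\mathbf{m}_i\in\mathbb{R}^3$. For $\mathbf{x}=(x_1,x_2,x_3)^\top\in\mathbb{R}^3$ let $\mathbf{g}^*_1(\mathbf{x})=(0,x_3,-x_2)^\top$, $\mathbf{g}^*_2(\mathbf{x})=(-x_3,0,x_1)^\top$, $\mathbf{g}^*_3(\mathbf{x})=(x_2,-x_1,0)^\top$. The vector fields $\mathbf{G}^{0,l}$ and $\mathbf{G}^{1,l}$ on $\prod_{i=0}^\infty\mathbb{R}^3$ have components $$[\mathbf{G}^{0,l}(\mathfrak{m})]_i=\tfrac{1}{\sqrt2}\mathbf{g}^*_l(\mathbf{m}_i)\ (i\ge0),\qquad [\mathbf{G}^{1,l}(\mathfrak{m})]_0=\tfrac1{\sqrt2}\mathbf{g}^*_l(\mathbf{m}_1),\qquad [\mathbf{G}^{1,l}(\mathfrak{m})]_i=\tfrac1{\sqrt2}\mathbf{g}^*_l(\mathbf{m}_{i-1})+\tfrac1{\sqrt2}\mathbf{g}^*_l(\mathbf{m}_{i+1})\ (i\ge1).$$ For $N\in\mathbb{N}_0$ and a linear vector field $\mathbf{g}$ on $\mathbb{R}^3$, $\mathcal{H}_{\mathbf{g},N}$ is the vector field on $\prod_{i=0}^\infty\mathbb{R}^3$ with components $$[\mathcal{H}_{\mathbf{g},N}(\mathfrak{m})]_i=\sum_{\substack{j\ge0\\ j\equiv i+N\ (\mathrm{mod}\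 2)}}\left(\binom{N}{\frac{N+j-i}{2}}-\binom{N}{\frac{N+i+j}{2}+1}\right)\mathbf{g}(\mathbf{m}_j),\qquad i\ge0,$$ with $\binom{N}{r}=0$ for $r<0$ or $r>N$ (the sum is finite). The Lie bracket of vector fields $f,g$ (on $\mathbb{R}^3$ or on $\prod_{i=0}^\infty\mathbb{R}^3$) is $[f,g]=Df\,g-Dg\,f$. *)

theory Defs
  imports "HOL-Analysis.Analysis"
begin

type_synonym seq3 = "nat \<Rightarrow> real ^ 3"

definition g_star :: "nat \<Rightarrow> real ^ 3 \<Rightarrow> real ^ 3" where
  "g_star l x =
     (if l = 1 then vector [0, x $ 3, - x $ 2]
      else if l = 2 then vector [- x $ 3, 0, x $ 1]
      else vector [x $ 2, - x $ 1, 0])"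

definition G0 :: "nat \<Rightarrow> seq3 \<Rightarrow> seq3" where
  "G0 l M = (\<lambda>i. (1 / sqrt 2) *\<^sub>R g_star l (M i))"

definition G1 :: "nat \<Rightarrow> seq3 \<Rightarrow> seq3" where
  "G1 l M = (\<lambda>i.
     if i = 0 then (1 / sqrt 2) *\<^sub>R g_star l (M 1)
     else (1 / sqrt 2) *\<^sub>R g_star l (M (i - 1)) + (1 / sqrt 2) *\<^sub>R g_star l (M (i + 1)))"

definition binom_int :: "nat \<Rightarrow> int \<Rightarrow> real" where
  "binom_int N r = (if r < 0 then 0 else real (N choose nat r))"

text \<open>The two divisions by 2 are exact on the index set of the sum. Only finitely many
  summands are nonzero (those with \<open>j \<le> i + N\<close>), so the infinite sum below is
  a finite one.\<close>

definition H_field :: "(real ^ 3 \<Rightarrow> real ^ 3) \<Rightarrow> nat \<Rightarrow> seq3 \<Rightarrow> seq3" where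
  "H_field g N M = (\<lambda>i.
     \<Sum>\<^sub>\<infinity>j \<in> {j. j mod 2 = (i + N) mod 2}.
       (binom_int N ((int N + int j - int i) div 2)
        - binom_int N ((int N + int i + int j) div 2 + 1)) *\<^sub>R g (M j))"

definition lie_bracket3 ::
    "(real ^ 3 \<Rightarrow> real ^ 3) \<Rightarrow> (real ^ 3 \<Rightarrow> real ^ 3) \<Rightarrow> real ^ 3 \<Rightarrow> real ^ 3" where
  "lie_bracket3 f g x = frechet_derivative f (at x) (g x) - frechet_derivative g (at x) (f x)"

text \<open>The sequence space with the product topology is a Frechet space but not a normed one,
  so \<open>Df(M)V\<close> is the directional derivative, the limit of the difference quotients in the
  product topology, which is the topology on the function type.\<close>

definition seq_deriv :: "(seq3 \<Rightarrow> seq3) \<Rightarrow> seq3 \<Rightarrow> seq3 \<Rightarrow> seq3" where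
  "seq_deriv f M V =
     Lim (at 0) (\<lambda>t::real. \<lambda>i. (f (\<lambda>j. M j + t *\<^sub>R V j) i - f M i) /\<^sub>R t)"

definition lie_bracket_seq :: "(seq3 \<Rightarrow> seq3) \<Rightarrow> (seq3 \<Rightarrow> seq3) \<Rightarrow> seq3 \<Rightarrow> seq3" where
  "lie_bracket_seq f g M = (\<lambda>i. seq_deriv f M (g M) i - seq_deriv g M (f M) i)"

definition scale_field :: "real \<Rightarrow> (seq3 \<Rightarrow> seq3) \<Rightarrow> seq3 \<Rightarrow> seq3" where
  "scale_field c f M = (\<lambda>i. c *\<^sub>R f M i)"

end

theory Submission
  imports Defs
begin

text \<open>Let \<open>T\<close> be the adjacency operator of the half line, so that the vector field
  \<open>sqrt 2 G\<^sup>1\<^sup>,\<^sup>l\<close> is \<open>T\<close> composed with \<open>g\<^sup>*\<^sub>l\<close> acting entrywise. By Pascal's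
  rule the coefficient matrices of the \<open>H_field g N\<close> satisfy the recursion of the powers of \<open>T\<close> (they count
  paths on the half line, by the reflection principle), so \<open>H_field g N\<close> is \<open>T ^^ N\<close> composed with \<open>g\<close>.
  Since \<open>T\<close> commutes with every linear map acting entrywise, the bracket of \<open>T\<^sup>a g\<close> and \<open>T\<^sup>b h\<close> is
  \<open>T\<^sup>a\<^sup>+\<^sup>b [g, h]\<close>.\<close>

definition half_line_adj :: "(nat \<Rightarrow> 'a) \<Rightarrow> nat \<Rightarrow> 'a::comm_monoid_add" where
  "half_line_adj X i = (if i = 0 then X 1 else X (i - 1) + X (i + 1))"

text \<open>The row index is an integer: the row \<open>-1\<close> vanishes, which absorbs the boundary case.\<close>

definition path_coeff :: "nat \<Rightarrow> int \<Rightarrow> nat \<Rightarrow> real" where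
  "path_coeff N i j = (if even (int N + int j - i)
     then binom_int N ((int N + int j - i) div 2) - binom_int N ((int N + i + int j) div 2 + 1)
     else 0)"

lemma binom_int_Suc: "binom_int (Suc N) r = binom_int N (r - 1) + binom_int N r"
proof (cases "r \<le> 0")
  case True
  then show ?thesis by (cases "r = 0") (auto simp: binom_int_def)
next
  case False
  then have "nat r = Suc (nat (r - 1))" by simp
  with False show ?thesis by (auto simp: binom_int_def)
qed

lemma binom_int_eq_0: "int N < r \<Longrightarrow> binom_int N r = 0"
  by (simp add: binom_int_def)

text \<open>With the exact half \<open>r\<close> as parameter both divisions by 2 disappear, and the
  reflected binomial sits at the shifted index.\<close>

lemma path_coeff_even:
  assumes "int N + int j - i = 2 * r"
  shows "path_coeff N i j = binom_int N r - binom_int N (r + i + 1)"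
proof -
  from assms have "int N + i + int j = 2 * (r + i)" by simp
  then have "(int N + i + int j) div 2 = r + i" by simp
  with assms show ?thesis by (simp add: path_coeff_def)
qed

lemma path_coeff_odd: "odd (int N + int j - i) \<Longrightarrow> path_coeff N i j = 0"
  by (simp add: path_coeff_def)

lemma path_coeff_Suc:
  "path_coeff (Suc N) i j = path_coeff N (i - 1) j + path_coeff N (i + 1) j"
proof (cases "even (int (Suc N) + int j - i)")
  case True
  then obtain r where r: "int (Suc N) + int j - i = 2 * r" by blast
  \<comment> \<open>Pascal's rule splits both binomials. Row \<open>i - 1\<close> keeps
    \<open>r\<close> and has reflected index \<open>r + i\<close>; row \<open>i + 1\<close> has
    \<open>r - 1\<close> and \<open>r + i + 1\<close>, so the four terms match.\<close>
  then have "int N + int j - (i - 1) = 2 * r" "int N + int j - (i + 1) = 2 * (r - 1)"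
    by simp_all
  note this[THEN path_coeff_even]
  then show ?thesis
    using path_coeff_even[OF r] binom_int_Suc[of N r] binom_int_Suc[of N "r + i + 1"]
    by simp
next
  case False
  then have "odd (int N + int j - (i - 1))" "odd (int N + int j - (i + 1))"
    by presburger+
  from this[THEN path_coeff_odd] path_coeff_odd[OF False] show ?thesis by simp
qed

text \<open>In row -1 the direct and the reflected index coincide, so the two binomials
  cancel.\<close>

lemma path_coeff_minus1: "path_coeff N (- 1) j = 0"
proof (cases "even (int N + int j - (- 1))")
  case True
  then obtain r where "int N + int j - (- 1) = 2 * r" by blast
  then show ?thesis by (simp add: path_coeff_even[of _ _ _ r])
qed (rule path_coeff_odd)

lemma path_coeff_0: "path_coeff 0 (int i) j = (if j = i then 1 else 0)"
proof (cases "even (int 0 + int j - int i)")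
  case True
  then obtain r where "int 0 + int j - int i = 2 * r" by blast
  \<comment> \<open>The reflected index is (i + j)/2 + 1 > 0, so its binomial over 0 vanishes; the
    direct one survives only for \<open>r = 0\<close>.\<close>
  then show ?thesis
    by (subst path_coeff_even[of _ _ _ r]) (auto simp: binom_int_def binomial_eq_0)
qed (auto simp: path_coeff_odd)

text \<open>A path of \<open>N\<close> steps from \<open>i\<close> cannot get past
  \<open>i + N\<close>; in terms of binomials, both lower indices exceed \<open>N\<close>.\<close>

lemma path_coeff_eq_0:
  assumes "i + N < j"
  shows "path_coeff N (int i) j = 0"
proof (cases "even (int N + int j - int i)")
  case True
  then obtain r where r: "int N + int j - int i = 2 * r" by blast
  with assms have "int N < r" by simp
  with path_coeff_even[OF r] show ?thesis by (simp add: binom_int_eq_0)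
qed (rule path_coeff_odd)

text \<open>The cutoff \<open>K\<close> is left free so that different rows and different
  \<open>N\<close> can be summed over one range. The parity condition on the index set passes into
  the zero values of \<open>path_coeff\<close>.\<close>

lemma H_field_finite:
  assumes "i + N \<le> K"
  shows "H_field g N M i = (\<Sum>j\<le>K. path_coeff N (int i) j *\<^sub>R g (M j))"
proof -
  have "H_field g N M i = (\<Sum>\<^sub>\<infinity>j\<in>{..K}. path_coeff N (int i) j *\<^sub>R g (M j))"
    unfolding H_field_def
  proof (rule infsum_cong_neutral)
    have parity: "j mod 2 = (i + N) mod 2 \<longleftrightarrow> even (int N + int j - int i)" for j
      by presburger
    show "path_coeff N (int i) j *\<^sub>R g (M j) = 0"
      if "j \<in> {..K} - {j. j mod 2 = (i + N) mod 2}" for j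
      using that parity[of j] by (simp add: path_coeff_def)
    have eq: "binom_int N ((int N + int j - int i) div 2)
        - binom_int N ((int N + int i + int j) div 2 + 1) = path_coeff N (int i) j"
      if "j mod 2 = (i + N) mod 2" for j
      using that parity[of j] by (simp add: path_coeff_def)
    show "(binom_int N ((int N + int j - int i) div 2)
        - binom_int N ((int N + int i + int j) div 2 + 1)) *\<^sub>R g (M j) = 0"
      if "j \<in> {j. j mod 2 = (i + N) mod 2} - {..K}" for j
      using that assms eq[of j] path_coeff_eq_0[of i N j] by simp
    show "(binom_int N ((int N + int j - int i) div 2)
        - binom_int N ((int N + int i + int j) div 2 + 1)) *\<^sub>R g (M j)
        = path_coeff N (int i) j *\<^sub>R g (M j)"
      if "j \<in> {j. j mod 2 = (i + N) mod 2} \<inter> {..K}" for j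
      using that eq[of j] by simp
  qed
  then show ?thesis by simp
qed

lemma H_field_Suc: "H_field g (Suc N) M = half_line_adj (H_field g N M)"
proof
  fix i
  \<comment> \<open>Row \<open>i\<close> for \<open>Suc N\<close> and row \<open>i + 1\<close> for
    \<open>N\<close> both reach exactly this far.\<close>
  define K where "K = i + N + 1"
  have "H_field g (Suc N) M i
      = (\<Sum>j\<le>K. path_coeff N (int i - 1) j *\<^sub>R g (M j))
        + (\<Sum>j\<le>K. path_coeff N (int (i + 1)) j *\<^sub>R g (M j))"
    by (simp add: H_field_finite[of _ _ K] K_def path_coeff_Suc scaleR_add_left sum.distrib
        add.commute)
  also have "(\<Sum>j\<le>K. path_coeff N (int (i + 1)) j *\<^sub>R g (M j)) = H_field g N M (i + 1)"
    by (rule H_field_finite[symmetric]) (simp add: K_def)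
  \<comment> \<open>For \<open>i = 0\<close> this is row -1, whose vanishing gives the boundary case
    of \<open>half_line_adj\<close>.\<close>
  also have "(\<Sum>j\<le>K. path_coeff N (int i - 1) j *\<^sub>R g (M j))
      = (if i = 0 then 0 else H_field g N M (i - 1))"
    by (simp add: path_coeff_minus1 H_field_finite[of _ _ K] K_def of_nat_diff)
  finally show "H_field g (Suc N) M i = half_line_adj (H_field g N M) i"
    by (simp add: half_line_adj_def)
qed

lemma H_field_eq_funpow: "H_field g N M = (half_line_adj ^^ N) (\<lambda>i. g (M i))"
proof (induction N)
  case 0
  have "H_field g 0 M i = g (M i)" for i
    by (simp add: H_field_finite[of i 0 i] path_coeff_0 if_distrib[of "\<lambda>c. c *\<^sub>R _"] sum.delta
        cong: if_cong)
  then show ?case by auto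
qed (simp add: H_field_Suc)

lemma funpow_half_line_adj_linear:
  assumes "linear h"
  shows "(half_line_adj ^^ N) (\<lambda>i. h (X i)) = (\<lambda>i. h ((half_line_adj ^^ N) X i))"
  by (induction N) (auto simp: half_line_adj_def linear_add[OF assms])

lemma funpow_half_line_adj_diff:
  fixes X Y :: "nat \<Rightarrow> 'a::ab_group_add"
  shows "(half_line_adj ^^ N) (\<lambda>i. X i - Y i)
    = (\<lambda>i. (half_line_adj ^^ N) X i - (half_line_adj ^^ N) Y i)"
  by (induction N) (auto simp: half_line_adj_def)

lemma funpow_half_line_adj_add_scaleR:
  fixes X Y :: "nat \<Rightarrow> 'a::real_vector"
  shows "(half_line_adj ^^ N) (\<lambda>i. X i + t *\<^sub>R Y i)
    = (\<lambda>i. (half_line_adj ^^ N) X i + t *\<^sub>R (half_line_adj ^^ N) Y i)"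
  by (induction N) (auto simp: half_line_adj_def scaleR_add_right)

text \<open>The difference quotient equals \<open>f V\<close> for every \<open>t \<noteq> 0\<close>,
  so it converges trivially, and uniqueness of limits in the Hausdorff product topology fixes the
  value of \<open>Lim\<close>.\<close>

lemma seq_deriv_linear:
  assumes "\<And>t. f (\<lambda>j. M j + t *\<^sub>R V j) = (\<lambda>i. f M i + t *\<^sub>R f V i)"
  shows "seq_deriv f M V = f V"
proof -
  have "((\<lambda>t::real. \<lambda>i. (f (\<lambda>j. M j + t *\<^sub>R V j) i - f M i) /\<^sub>R t) \<longlongrightarrow> f V) (at 0)"
    by (rule tendsto_eventually) (auto simp: eventually_at_filter assms)
  then show ?thesis
    unfolding seq_deriv_def by (intro tendsto_Lim) auto
qed

lemma lie_bracket3_linear: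
  assumes "linear g" "linear h"
  shows "lie_bracket3 g h x = g (h x) - h (g x)"
  using assms[THEN linear_imp_has_derivative, THEN frechet_derivative_at]
  by (simp add: lie_bracket3_def)

lemma seq_deriv_funpow_half_line_adj:
  assumes "linear g"
  shows "seq_deriv (\<lambda>M. (half_line_adj ^^ N) (\<lambda>i. g (M i))) M V
    = (half_line_adj ^^ N) (\<lambda>i. g (V i))"
  by (rule seq_deriv_linear)
    (simp add: linear_add[OF assms] linear_scale[OF assms] funpow_half_line_adj_add_scaleR)

lemma lie_bracket_seq_H_field:
  assumes g: "linear g" and h: "linear h"
  shows "lie_bracket_seq (H_field g a) (H_field h b) = H_field (lie_bracket3 g h) (a + b)"
proof
  fix M
  have "lie_bracket_seq (H_field g a) (H_field h b) M
      = (\<lambda>i. (half_line_adj ^^ a) (\<lambda>i. g ((half_line_adj ^^ b) (\<lambda>i. h (M i)) i)) i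
           - (half_line_adj ^^ b) (\<lambda>i. h ((half_line_adj ^^ a) (\<lambda>i. g (M i)) i)) i)"
    unfolding lie_bracket_seq_def H_field_eq_funpow
    by (simp add: seq_deriv_funpow_half_line_adj g h)
  also have "\<dots> = (\<lambda>i. (half_line_adj ^^ (a + b)) (\<lambda>i. g (h (M i))) i
           - (half_line_adj ^^ (b + a)) (\<lambda>i. h (g (M i))) i)"
    \<comment> \<open>Linearity moves \<open>g\<close> and \<open>h\<close> inside the power of the
      other field, after which the exponents add.\<close>
    by (simp add: funpow_half_line_adj_linear[OF g, symmetric]
        funpow_half_line_adj_linear[OF h, symmetric] funpow_add)
  also have "\<dots> = H_field (lie_bracket3 g h) (a + b) M"
    by (simp add: H_field_eq_funpow lie_bracket3_linear[OF g h] funpow_half_line_adj_diff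
        add.commute)
  finally show "lie_bracket_seq (H_field g a) (H_field h b) M
      = H_field (lie_bracket3 g h) (a + b) M" .
qed

lemma linear_g_star: "linear (g_star l)"
  by (rule linearI) (auto simp: g_star_def vec_eq_iff forall_3 algebra_simps)

text \<open>The factor \<open>sqrt 2\<close> cancels the normalisation. \<open>G0\<close> and
  \<open>G1\<close> thus become the members \<open>N = 0\<close> and \<open>N = 1\<close> of the
  family \<open>H_field\<close>, and all four claims are instances of one bracket formula.\<close>

lemma scale_G0: "scale_field (sqrt 2) (G0 m) = H_field (g_star m) 0"
  by (simp add: fun_eq_iff scale_field_def G0_def H_field_eq_funpow)

lemma scale_G1: "scale_field (sqrt 2) (G1 m) = H_field (g_star m) 1"
  by (simp add: fun_eq_iff scale_field_def G1_def H_field_eq_funpow half_line_adj_def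
      scaleR_add_right)

theorem lemmaE1:
  fixes k m n :: nat
  assumes "k \<ge> 2" and "m \<in> {1, 2, 3}" and "n \<in> {1, 2, 3}"
  shows "lie_bracket_seq (H_field (g_star n) (2 * k)) (scale_field (sqrt 2) (G0 m))
           = H_field (lie_bracket3 (g_star n) (g_star m)) (2 * k)
       \<and> lie_bracket_seq (H_field (g_star n) (2 * k)) (scale_field (sqrt 2) (G1 m))
           = H_field (lie_bracket3 (g_star n) (g_star m)) (2 * k + 1)
       \<and> lie_bracket_seq (H_field (g_star n) (2 * k + 1)) (scale_field (sqrt 2) (G0 m))
           = H_field (lie_bracket3 (g_star n) (g_star m)) (2 * k + 1)
       \<and> lie_bracket_seq (H_field (g_star n) (2 * k + 1)) (scale_field (sqrt 2) (G1 m))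
           = H_field (lie_bracket3 (g_star n) (g_star m)) (2 * k + 2)"
  by (simp add: scale_G0 scale_G1 lie_bracket_seq_H_field linear_g_star)

end
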